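(* Let $\Phi=\{\phi_j\}_{j\ge1}$ be a Schramm sequence, let $\{q_n\}_{n\ge1}$ be a sequence of real numbers with $1\le q_n\uparrow q\le\infty$, and let $\{\delta_n\}_{n\ge1}$ be a sequence of real numbers with $2\le\delta_n\uparrow\infty$. Then the embedding $\Phi\mathrm{BV}\subseteq\mathrm{BV}^{(q_n\uparrow q)}$ holds if and only if $$\limsup_{n\to\infty}\ \max_{1\le k\le\delta_n}k^{\frac1{q_n}}\,\Phi_k^{-1}(1)<\infty ,$$ where the maximum is over integers $k$.
   Context: A Schramm sequence is a sequence $\Phi=\{\phi_j\}_{j=1}^\infty$ of increasing convex (real-valued) functions on $[0,\infty)$ with $\phi_j(0)=0$ such that, for all $x>0$, $0<\phi_{j+1}(x)\le\phi_j(x)$ for all $j$ and $\sum_{j=1}^\infty\phi_j(x)=\infty$. For $k\ge1$, $\Phi_k(x):=\sum_{j=1}^k\phi_j(x)$, $x\ge0$; this is a strictly increasing convex function on $[0,\infty)$ with $\Phi_k(0)=0$, and $\Phi_k^{-1}$ denotes its inverse function. The notation $q_n\uparrow q$ means that $\{q_n\}$ is nondecreasing (possibly constant) with limit $q$; $\delta_n\uparrow\infty$ means nondecreasing with limit $\infty$. All functions are real-valued on $[0,1]$. For an interval $I\subseteq[0,1]$, $f(I):=f(\sup I)-f(\inf I)$ and $|I|$ is its length. $V_\Phi(f):=\sup\sum_{j=1}^s\phi_j(|f(I_j)|)$, the supremum being over all finite (ordered) collections $\{I_j\}_{j=1}^s$ of nonoverlapping subintervals of $[0,1]$. $\Phi\mathrm{BV}$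 is the linear space of all $f$ such that $V_\Phi(cf)<\infty$ for some $c>0$. $\mathrm{BV}^{(q_n\uparrow q)}$ (depending also on $\{\delta_n\}$) is the set of all $f$ such that $$\sup_{n\ge1}\ \sup_{\{I_j\}}\Big(\sum_{j=1}^s|f(I_j)|^{q_n}\Big)^{1/q_n}<\infty,$$ where, for each $n$, the inner supremum is over all finite collections $\{I_j\}_{j=1}^s$ of nonoverlapping subintervals of $[0,1]$ with $\inf_j|I_j|\ge 1/\delta_n$. *)

theory Defs
  imports "HOL-Analysis.Analysis"
begin

text \<open>All sequences are indexed by the positive integers; values at index \<open>0\<close> never matter.
  Functions on \<open>[0,1]\<close> are represented by functions \<open>real \<Rightarrow> real\<close>, of which only the
  values on \<open>[0,1]\<close> are ever used.\<close>

text \<open>Strict monotonicity of each function follows from convexity, \<open>\<phi> j 0 = 0\<close> and positivity.\<close>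

definition schramm_sequence :: "(nat \<Rightarrow> real \<Rightarrow> real) \<Rightarrow> bool" where
  "schramm_sequence \<phi> \<longleftrightarrow>
     (\<forall>j\<ge>1. mono_on {0..} (\<phi> j) \<and> convex_on {0..} (\<phi> j) \<and> \<phi> j 0 = 0) \<and>
     (\<forall>x>0. (\<forall>j\<ge>1. 0 < \<phi> (Suc j) x \<and> \<phi> (Suc j) x \<le> \<phi> j x) \<and>
            filterlim (\<lambda>n. \<Sum>j=1..n. \<phi> j x) at_top sequentially)"

definition schramm_sum :: "(nat \<Rightarrow> real \<Rightarrow> real) \<Rightarrow> nat \<Rightarrow> real \<Rightarrow> real" where
  "schramm_sum \<phi> k x = (\<Sum>j=1..k. \<phi> j x)"

definition schramm_sum_inv :: "(nat \<Rightarrow> real \<Rightarrow> real) \<Rightarrow> nat \<Rightarrow> real \<Rightarrow> real" where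
  "schramm_sum_inv \<phi> k = inv_into {0..} (schramm_sum \<phi> k)"

definition interval_incr :: "(real \<Rightarrow> real) \<Rightarrow> real set \<Rightarrow> real" where
  "interval_incr f I = f (Sup I) - f (Inf I)"

definition interval_length :: "real set \<Rightarrow> real" where
  "interval_length I = Sup I - Inf I"

text \<open>\<open>I 1, \<dots>, I s\<close> are nonempty subintervals of \<open>[0,1]\<close> (open, closed, half-open or a single
  point); nonoverlapping means that they have at most endpoints in common.\<close>

definition nonoverlapping_intervals :: "nat \<Rightarrow> (nat \<Rightarrow> real set) \<Rightarrow> bool" where
  "nonoverlapping_intervals s I \<longleftrightarrow>
     (\<forall>j\<in>{1..s}. is_interval (I j) \<and> I j \<noteq> {} \<and> I j \<subseteq> {0..1}) \<and>
     disjoint_family_on (\<lambda>j. interior (I j)) {1..s}"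

definition schramm_variation :: "(nat \<Rightarrow> real \<Rightarrow> real) \<Rightarrow> (real \<Rightarrow> real) \<Rightarrow> ereal" where
  "schramm_variation \<phi> f =
     (SUP (s, I) \<in> {(s, I). nonoverlapping_intervals s I}.
        ereal (\<Sum>j=1..s. \<phi> j \<bar>interval_incr f (I j)\<bar>))"

definition Phi_BV :: "(nat \<Rightarrow> real \<Rightarrow> real) \<Rightarrow> (real \<Rightarrow> real) set" where
  "Phi_BV \<phi> = {f. \<exists>c>0. schramm_variation \<phi> (\<lambda>x. c * f x) < \<infinity>}"

definition q_variation :: "real \<Rightarrow> real \<Rightarrow> (real \<Rightarrow> real) \<Rightarrow> ereal" where
  "q_variation p d f =
     (SUP (s, I) \<in> {(s, I). nonoverlapping_intervals s I \<and>
                            (\<forall>j\<in>{1..s}. interval_length (I j) \<ge> 1 / d)}.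
        ereal ((\<Sum>j=1..s. \<bar>interval_incr f (I j)\<bar> powr p) powr (1 / p)))"

definition BV_seq :: "(nat \<Rightarrow> real) \<Rightarrow> (nat \<Rightarrow> real) \<Rightarrow> (real \<Rightarrow> real) set" where
  "BV_seq q \<delta> = {f. (SUP n\<in>{1..}. q_variation (q n) (\<delta> n) f) < \<infinity>}"

end

theory Submission
  imports Defs
begin

text \<open>
  Write \<open>\<Phi>\<^sub>k = \<phi>\<^sub>1 + \<dots> + \<phi>\<^sub>k\<close> and \<open>A\<^sub>k\<close> for the point with \<open>\<Phi>\<^sub>k(A\<^sub>k) = 1\<close>. Up to a factor \<open>6\<close>,
  the maximum of \<open>k powr (1/q) * A\<^sub>k\<close> over \<open>k \<le> \<delta>\<close> is the largest \<open>\<ell>\<^sup>q\<close> norm of numbers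
  \<open>x\<^sub>1 \<ge> \<dots> \<ge> x\<^sub>s \<ge> 0\<close> with \<open>s \<le> \<delta>\<close> and \<open>\<Sum> \<phi>\<^sub>j(x\<^sub>j) \<le> 1\<close>: the value for \<open>k\<close> is the norm of
  \<open>k\<close> copies of \<open>A\<^sub>k\<close>, and nothing else does essentially better.

  Sufficiency. At most \<open>\<delta>\<close> nonoverlapping intervals of length at least \<open>1/\<delta>\<close> fit into the unit
  interval. After scaling \<open>f\<close>, the absolute increments over them, in decreasing order, are numbers
  \<open>x\<^sub>1 \<ge> \<dots> \<ge> x\<^sub>s\<close> as above. If \<open>M\<close> bounds the maxima, then \<open>\<Phi>\<^sub>k(M k powr (-1/q)) \<ge> 1\<close> for all
  \<open>k \<le> s\<close>. This gives at once the weak bound \<open>x\<^sub>k \<le> M k powr (-1/q)\<close>, which bounds the sum of the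
  \<open>q\<close>-th powers only up to a factor of order \<open>ln s\<close>. The logarithm is removed by Abel summation: with
  \<open>x\<^sub>s\<^sub>+\<^sub>1 = 0\<close>, the sum \<open>\<Sum> \<phi>\<^sub>j(x\<^sub>j)\<close> equals \<open>\<Sum> (\<Phi>\<^sub>i(x\<^sub>i) - \<Phi>\<^sub>i(x\<^sub>i\<^sub>+\<^sub>1))\<close>, and each summand dominates
  \<open>i (u\<^sub>i - u\<^sub>i\<^sub>+\<^sub>1) / (2 q)\<close>, where \<open>u\<^sub>i\<close> is \<open>(x\<^sub>i / M) powr q\<close> cut off below at \<open>1/s\<close> (lemma
  \<open>schramm_sum_increment_ge\<close>). Summing up, \<open>\<Sum> u\<^sub>i \<le> 2 q + 1\<close>; the factor \<open>q\<close> is harmless since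
  \<open>q powr (1/q)\<close> is bounded. Hence the constant does not depend on \<open>n\<close> (lemma
  \<open>sum_powr_le_of_sum_schramm_le_one\<close>).

  Necessity. If the maxima are unbounded, choose blocks \<open>(n\<^sub>i, k\<^sub>i)\<close> with \<open>k powr (1/q) * A\<^sub>k \<ge> 4\<^sup>i\<close> for
  \<open>k = k\<^sub>i\<close> and \<open>q\<close> at index \<open>n\<^sub>i\<close>. Let \<open>f\<close> have spikes of height \<open>(1/2)\<^sup>i A\<^sub>k\<close> at about \<open>k\<^sub>i / 2\<close> points for
  each \<open>i\<close> and vanish elsewhere. A point is an endpoint of at most two nonoverlapping nondegenerate
  intervals, so block \<open>i\<close> contributes at most \<open>2 (1/2)\<^sup>i\<close> to any sum in the \<open>\<Phi>\<close>-variation, and \<open>f\<close> has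
  finite \<open>\<Phi>\<close>-variation (lemma \<open>spikes_variation_le\<close>). All the points are irrational, so intervals of
  length at least \<open>1/\<delta>\<close> from a point of block \<open>i\<close> to a nearby rational see the full height of the
  spike whatever the other blocks do; their \<open>\<ell>\<^sup>q\<close> norm is at least \<open>2\<^sup>i / 2\<close>.
\<close>

section \<open>Partial sums of a Schramm sequence\<close>

text \<open>Convexity enters the whole argument only through this bound and through the continuity
  that makes \<open>\<Phi>\<^sub>k\<close> attain the value \<open>1\<close>.\<close>

lemma schramm_term_scale_le:
  assumes "schramm_sequence \<phi>" "j \<ge> 1" "0 \<le> t" "t \<le> 1" "0 \<le> x"
  shows "\<phi> j (t * x) \<le> t * \<phi> j x"
proof -
  have "convex_on {0..} (\<phi> j)" "\<phi> j 0 = 0"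
    using assms by (auto simp: schramm_sequence_def)
  then have "\<phi> j ((1 - t) *\<^sub>R 0 + t *\<^sub>R x) \<le> (1 - t) * \<phi> j 0 + t * \<phi> j x"
    using assms by (intro convex_onD) auto
  then show ?thesis
    using \<open>\<phi> j 0 = 0\<close> by simp
qed

lemma schramm_term_mono:
  assumes "schramm_sequence \<phi>" "j \<ge> 1" "0 \<le> x" "x \<le> y"
  shows "\<phi> j x \<le> \<phi> j y"
  using assms by (auto simp: schramm_sequence_def mono_on_def)

lemma schramm_term_pos:
  assumes "schramm_sequence \<phi>" "j \<ge> 1" "0 < x"
  shows "0 < \<phi> j x"
proof -
  have "0 < \<phi> (Suc j) x" "\<phi> (Suc j) x \<le> \<phi> j x"
    using assms by (auto simp: schramm_sequence_def)
  then show ?thesis by linarith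
qed

lemma schramm_term_nonneg:
  assumes "schramm_sequence \<phi>" "j \<ge> 1" "0 \<le> x"
  shows "0 \<le> \<phi> j x"
  using schramm_term_pos[OF assms(1,2), of x] assms
  by (cases "x = 0") (auto simp: schramm_sequence_def)

lemma schramm_term_antimono_index:
  assumes "schramm_sequence \<phi>" "1 \<le> i" "i \<le> j" "0 \<le> x"
  shows "\<phi> j x \<le> \<phi> i x"
proof (cases "x = 0")
  case True
  then show ?thesis using assms by (auto simp: schramm_sequence_def)
next
  case False
  show ?thesis using assms(3)
  proof (induction j rule: dec_induct)
    case (step n)
    have "\<phi> (Suc n) x \<le> \<phi> n x"
      using assms False step.hyps by (auto simp: schramm_sequence_def)
    then show ?case using step.IH by linarith
  qed simp
qed

lemma schramm_sum_scale_le: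
  assumes "schramm_sequence \<phi>" "0 \<le> t" "t \<le> 1" "0 \<le> x"
  shows "schramm_sum \<phi> k (t * x) \<le> t * schramm_sum \<phi> k x"
  unfolding schramm_sum_def sum_distrib_left
  by (intro sum_mono schramm_term_scale_le[OF assms(1)] assms) auto

lemma schramm_sum_pos:
  assumes "schramm_sequence \<phi>" "k \<ge> 1" "0 < x"
  shows "0 < schramm_sum \<phi> k x"
  unfolding schramm_sum_def using assms by (intro sum_pos schramm_term_pos[OF assms(1)]) auto

lemma schramm_sum_nonneg:
  assumes "schramm_sequence \<phi>" "0 \<le> x"
  shows "0 \<le> schramm_sum \<phi> k x"
  unfolding schramm_sum_def using assms by (intro sum_nonneg schramm_term_nonneg[OF assms(1)]) auto

lemma schramm_sum_mono:
  assumes "schramm_sequence \<phi>" "0 \<le> x" "x \<le> y"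
  shows "schramm_sum \<phi> k x \<le> schramm_sum \<phi> k y"
  unfolding schramm_sum_def using assms by (intro sum_mono schramm_term_mono[OF assms(1)]) auto

lemma schramm_sum_mono_index:
  assumes "schramm_sequence \<phi>" "0 \<le> x" "k \<le> l"
  shows "schramm_sum \<phi> k x \<le> schramm_sum \<phi> l x"
  unfolding schramm_sum_def using assms
  by (intro sum_mono2 schramm_term_nonneg[OF assms(1)]) auto

lemma schramm_sum_strict_mono:
  assumes "schramm_sequence \<phi>" "k \<ge> 1" "0 \<le> x" "x < y"
  shows "schramm_sum \<phi> k x < schramm_sum \<phi> k y"
proof -
  have "schramm_sum \<phi> k (x / y * y) \<le> x / y * schramm_sum \<phi> k y"
    using assms by (intro schramm_sum_scale_le) auto
  also have "\<dots> < 1 * schramm_sum \<phi> k y"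
    using assms schramm_sum_pos[of \<phi> k y] by (intro mult_strict_right_mono) auto
  finally show ?thesis using assms by simp
qed

text \<open>By convexity, the chord of \<open>\<Phi>\<^sub>k\<close> over \<open>[y, x]\<close> is at least as steep as the one over \<open>[0, x]\<close>.\<close>

lemma schramm_sum_secant_ge:
  assumes "schramm_sequence \<phi>" "0 \<le> y" "y \<le> x" "0 < x"
  shows "(1 - y / x) * schramm_sum \<phi> k x \<le> schramm_sum \<phi> k x - schramm_sum \<phi> k y"
proof -
  have "schramm_sum \<phi> k (y / x * x) \<le> y / x * schramm_sum \<phi> k x"
    using assms by (intro schramm_sum_scale_le) auto
  then show ?thesis using assms by (simp add: algebra_simps)
qed

text \<open>The average \<open>\<Phi>\<^sub>n / n\<close> of decreasing terms decreases. This compares different partial sums at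
  the same point.\<close>

lemma schramm_sum_average_antimono:
  assumes "schramm_sequence \<phi>" "1 \<le> i" "i \<le> n" "0 \<le> x"
  shows "real i * schramm_sum \<phi> n x \<le> real n * schramm_sum \<phi> i x"
  using assms(3)
proof (induction n rule: dec_induct)
  case (step m)
  have "real i * \<phi> (Suc m) x = (\<Sum>j=1..i. \<phi> (Suc m) x)"
    by simp
  also have "\<dots> \<le> schramm_sum \<phi> i x"
    unfolding schramm_sum_def using assms step.hyps
    by (intro sum_mono schramm_term_antimono_index[OF assms(1)]) auto
  finally show ?case
    using step.IH by (simp add: schramm_sum_def algebra_simps)
qed simp

text \<open>Among index sets of the same size an initial segment gives the largest sum, since the terms
  decrease in the index.\<close>

lemma schramm_sum_over_subset_le:
  assumes "schramm_sequence \<phi>" "0 \<le> x" "finite J" "J \<subseteq> {1..}"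
  shows "(\<Sum>j\<in>J. \<phi> j x) \<le> schramm_sum \<phi> (card J) x"
  using assms(3,4)
proof (induction J rule: finite_linorder_max_induct)
  case empty
  then show ?case by (simp add: schramm_sum_def)
next
  case (insert b A)
  have "A \<subseteq> {1..<b}" using insert by auto
  then have "card A \<le> card {1..<b}" by (intro card_mono) auto
  then have "Suc (card A) \<le> b" using insert by auto
  then have "\<phi> b x \<le> \<phi> (Suc (card A)) x"
    using assms by (intro schramm_term_antimono_index[OF assms(1)]) auto
  moreover have "b \<notin> A" using insert by auto
  ultimately show ?case
    using insert by (simp add: schramm_sum_def)
qed

text \<open>The intermediate value theorem is applied away from \<open>0\<close>, because a convex function can jump at
  the boundary of its domain.\<close>

lemma schramm_sum_attains_one:
  assumes "schramm_sequence \<phi>" "k \<ge> 1"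
  shows "\<exists>x>0. schramm_sum \<phi> k x = 1"
proof -
  let ?F = "schramm_sum \<phi> k"
  have F1: "0 < ?F 1" using schramm_sum_pos assms by simp
  \<comment> \<open>Scaling to and from the point 1 brackets the value 1 between two positive arguments.\<close>
  define a where "a = min 1 (1 / ?F 1)"
  define b where "b = max 1 (1 / ?F 1)"
  have ab: "0 < a" "a \<le> b" "a \<le> 1" "1 \<le> b" "a * ?F 1 \<le> 1" "b * ?F 1 \<ge> 1"
    using F1 by (auto simp: a_def b_def min_def max_def field_simps)
  have "?F (a * 1) \<le> a * ?F 1"
    using ab assms by (intro schramm_sum_scale_le) auto
  then have Fa: "?F a \<le> 1" using ab by simp
  have "?F (1 / b * b) \<le> 1 / b * ?F b"
    using ab assms by (intro schramm_sum_scale_le) auto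
  then have "b * ?F 1 \<le> ?F b" using ab by (simp add: field_simps)
  then have Fb: "1 \<le> ?F b" using ab by linarith
  have "continuous_on {0<..} (\<phi> j)" if "j \<ge> 1" for j
  proof (rule convex_on_continuous)
    have "convex_on {0..} (\<phi> j)" using assms that by (auto simp: schramm_sequence_def)
    then show "convex_on {0<..} (\<phi> j)"
      by (rule convex_on_subset) auto
  qed auto
  then have "continuous_on {0<..} ?F"
    unfolding schramm_sum_def[abs_def] by (intro continuous_on_sum) auto
  then have "continuous_on {a..b} ?F"
    by (rule continuous_on_subset) (use ab in auto)
  from IVT'[OF Fa Fb _ this] ab obtain x where "a \<le> x" "x \<le> b" "?F x = 1" by auto
  then show ?thesis using ab by (intro exI[of _ x]) auto
qed

lemma schramm_sum_inv_one:
  assumes "schramm_sequence \<phi>" "k \<ge> 1"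
  shows "0 < schramm_sum_inv \<phi> k 1" "schramm_sum \<phi> k (schramm_sum_inv \<phi> k 1) = 1"
proof -
  obtain x where x: "x > 0" "schramm_sum \<phi> k x = 1"
    using schramm_sum_attains_one[OF assms] by blast
  have 1: "1 \<in> schramm_sum \<phi> k ` {0..}" using x by (intro image_eqI[of _ _ x]) auto
  show eq: "schramm_sum \<phi> k (schramm_sum_inv \<phi> k 1) = 1"
    unfolding schramm_sum_inv_def using 1 by (rule f_inv_into_f)
  have "schramm_sum_inv \<phi> k 1 \<in> {0..}"
    unfolding schramm_sum_inv_def using 1 by (rule inv_into_into)
  moreover have "schramm_sum \<phi> k 0 = 0"
    unfolding schramm_sum_def using assms by (intro sum.neutral) (auto simp: schramm_sequence_def)
  then have "schramm_sum_inv \<phi> k 1 \<noteq> 0" using eq by auto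
  ultimately show "0 < schramm_sum_inv \<phi> k 1" by auto
qed

lemma schramm_sum_inv_one_antimono:
  assumes "schramm_sequence \<phi>" "1 \<le> k" "k \<le> l"
  shows "schramm_sum_inv \<phi> l 1 \<le> schramm_sum_inv \<phi> k 1"
proof (rule ccontr)
  let ?a = "schramm_sum_inv \<phi> k 1" and ?b = "schramm_sum_inv \<phi> l 1"
  assume "\<not> ?b \<le> ?a"
  then have "schramm_sum \<phi> k ?a < schramm_sum \<phi> k ?b"
    using assms schramm_sum_inv_one[of \<phi> k] by (intro schramm_sum_strict_mono) auto
  also have "\<dots> \<le> schramm_sum \<phi> l ?b"
    using assms schramm_sum_inv_one[of \<phi> l] by (intro schramm_sum_mono_index) auto
  finally show False using assms schramm_sum_inv_one[of \<phi>] by auto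
qed

section \<open>A modular bound controls power sums\<close>

text \<open>Bernoulli's inequality \<open>1 - t powr q \<le> q (1 - t)\<close> at \<open>t = y / x\<close>, a case of Young's inequality.\<close>

lemma powr_secant_le:
  fixes q x y :: real
  assumes "1 \<le> q" "0 < x" "0 \<le> y"
  shows "x powr q - y powr q \<le> q * (1 - y / x) * x powr q"
proof -
  define t where "t = y / x"
  have t: "0 \<le> t" using assms by (simp add: t_def)
  have "t \<le> 1 / q * t powr q + (1 - 1 / q)"
  proof (cases "t = 0")
    case False
    then have "(t powr q) powr (1 / q) * 1 powr (1 - 1 / q) \<le> 1 / q * t powr q + (1 - 1 / q) * 1"
      using assms by (intro Youngs_inequality_0) auto
    then show ?thesis using assms t by (simp add: powr_powr)
  qed (use assms in auto)
  then have "q * t \<le> t powr q + (q - 1)"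
    using assms mult_left_mono[of t "1 / q * t powr q + (1 - 1 / q)" q] by (simp add: algebra_simps)
  then have "(1 - t powr q) * x powr q \<le> q * (1 - t) * x powr q"
    using assms by (intro mult_right_mono) (auto simp: algebra_simps)
  moreover have "t powr q * x powr q = y powr q"
    using assms t by (simp add: t_def flip: powr_mult)
  ultimately show ?thesis by (simp add: t_def algebra_simps)
qed

text \<open>For \<open>g = \<phi>\<close> this writes a sum of \<open>\<phi>\<^sub>i(x\<^sub>i)\<close> through increments of the partial sums \<open>\<Phi>\<^sub>i\<close>, the
  functions for which lower bounds are given; for \<open>g\<^sub>j(y) = y\<close> it is the usual summation by parts.\<close>

lemma abel_summation:
  fixes g :: "nat \<Rightarrow> 'a \<Rightarrow> real"
  shows "(\<Sum>i=1..s. (\<Sum>j=1..i. g j (x i)) - (\<Sum>j=1..i. g j (x (Suc i)))) =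
         (\<Sum>i=1..s. g i (x i)) - (\<Sum>j=1..s. g j (x (Suc s)))"
  by (induction s) auto

text \<open>Let \<open>u = (x / M) powr q\<close>, so that \<open>u \<le> 1 / i\<close>. If \<open>u > 1 / s\<close>, some \<open>N\<close> with
  \<open>i \<le> N \<le> s\<close> is comparable to \<open>1 / u\<close>, and \<open>\<Phi>\<^sub>N(x) \<ge> 1\<close> by hypothesis; averaging transfers this
  to \<open>\<Phi>\<^sub>i(x) \<ge> i / N \<ge> i u / 2\<close>, and the secant bounds for \<open>\<Phi>\<^sub>i\<close> and for the power turn the values into
  increments. For \<open>u < 1 / s\<close> no such \<open>N\<close> exists, which is why the powers are cut off at \<open>1 / s\<close>;
  the cut-off adds at most \<open>1\<close> to a sum of \<open>s\<close> powers.\<close>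

lemma schramm_sum_increment_ge:
  fixes i s :: nat
  assumes sch: "schramm_sequence \<phi>" and q: "1 \<le> q" and M: "0 < M"
    and hyp: "\<And>k. k \<in> {1..s} \<Longrightarrow> 1 \<le> schramm_sum \<phi> k (M * real k powr (-1 / q))"
    and i: "i \<in> {1..s}" and xy: "0 \<le> y" "y \<le> x" and x: "x \<le> M * real i powr (-1 / q)"
  shows "real i * (max ((x / M) powr q) (1 / s) - max ((y / M) powr q) (1 / s))
          \<le> 2 * q * (schramm_sum \<phi> i x - schramm_sum \<phi> i y)"
proof -
  define u v where "u = (x / M) powr q" and "v = (y / M) powr q"
  have vu: "v \<le> u" unfolding u_def v_def using xy M q by (intro powr_mono2) (auto simp: divide_right_mono)
  have s: "s \<ge> 1" using i by auto
  have "0 \<le> 2 * q * (schramm_sum \<phi> i x - schramm_sum \<phi> i y)"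
    using schramm_sum_mono[OF sch xy] q by simp
  moreover have "real i * (max u (1 / s) - max v (1 / s))
          \<le> 2 * q * (schramm_sum \<phi> i x - schramm_sum \<phi> i y)" if us: "1 / s < u"
  proof -
    have u0: "u > 0" using us s by (smt (verit) divide_nonneg_nonneg of_nat_0_le_iff)
    then have x0: "x > 0" using xy by (cases "x = 0") (auto simp: u_def)
    have x_eq: "x = M * u powr (1 / q)"
      using x0 M q by (simp add: u_def powr_powr)
    have "u \<le> (real i powr (-1 / q)) powr q"
      unfolding u_def using x x0 M q by (intro powr_mono2) (auto simp: field_simps)
    also have "\<dots> = real i powr (-1)" using q by (simp add: powr_powr)
    also have "\<dots> = 1 / i" using i by (simp add: powr_minus_divide)
    finally have ui: "u \<le> 1 / i" .
    define N where "N = nat \<lceil>1 / u\<rceil>"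
    have N: "real N \<ge> 1 / u" "real N < 1 / u + 1"
      using u0 by (auto simp: N_def) linarith+
    have "real i \<le> 1 / u" using ui u0 i by (simp add: field_simps)
    then have iN: "i \<le> N" using N by linarith
    have "1 / u \<le> s" using us u0 s by (simp add: field_simps)
    then have Ns: "N \<le> s" by (simp add: N_def ceiling_le_iff)
    have "1 \<le> i" using i by auto
    then have N1: "1 \<le> N" using iN by auto
    have "1 / N \<le> u" using N u0 N1 by (simp add: field_simps)
    then have "real N powr (-1 / q) \<le> u powr (1 / q)"
      using N1 q powr_mono2[of "1/q" "1/N" u] by (simp add: powr_divide powr_minus_divide)
    then have "1 \<le> schramm_sum \<phi> N x"
      using hyp[of N] N1 Ns schramm_sum_mono[OF sch, of "M * real N powr (-1 / q)" x N] M x_eq by auto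
    then have "real i * 1 \<le> real i * schramm_sum \<phi> N x" by (intro mult_left_mono) auto
    also have "\<dots> \<le> real N * schramm_sum \<phi> i x"
      using schramm_sum_average_antimono[OF sch \<open>1 \<le> i\<close> iN] x0 by simp
    finally have "real i \<le> real N * schramm_sum \<phi> i x" by simp
    also have "\<dots> \<le> (2 / u) * schramm_sum \<phi> i x"
    proof (intro mult_right_mono)
      have "1 \<le> 1 / u" using \<open>real i \<le> 1 / u\<close> \<open>1 \<le> i\<close> by linarith
      then show "real N \<le> 2 / u" using N by (simp add: field_simps)
    qed (use schramm_sum_nonneg[OF sch] x0 in simp)
    finally have Phi: "real i * u \<le> 2 * schramm_sum \<phi> i x"
      using u0 by (simp add: field_simps)
    have "real i * (max u (1 / s) - max v (1 / s)) \<le> real i * (u - v)"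
      using us by (intro mult_left_mono) auto
    also have "\<dots> \<le> real i * (q * (1 - y / x) * u)"
      using powr_secant_le[OF q, of "x / M" "y / M"] x0 xy M
      by (intro mult_left_mono) (auto simp: u_def v_def)
    also have "\<dots> = q * (1 - y / x) * (real i * u)" by simp
    also have "\<dots> \<le> q * (1 - y / x) * (2 * schramm_sum \<phi> i x)"
      using Phi q xy x0 by (intro mult_left_mono) auto
    also have "\<dots> = 2 * q * ((1 - y / x) * schramm_sum \<phi> i x)" by simp
    also have "\<dots> \<le> 2 * q * (schramm_sum \<phi> i x - schramm_sum \<phi> i y)"
      using schramm_sum_secant_ge[OF sch xy x0] q by (intro mult_left_mono) auto
    finally show ?thesis .
  qed
  ultimately show ?thesis
    unfolding u_def[symmetric] v_def[symmetric] using vu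
    by (cases "1 / real s < u") (auto simp: max_def)
qed

text \<open>The increment bounds sum up, by Abel summation on both sides, to a bound \<open>(2 q + 1) M powr q\<close>
  on the power sum; the constant becomes independent of \<open>q\<close> because \<open>3 q \<le> 6 powr q\<close>.\<close>

lemma sum_powr_le_of_sum_schramm_le_one:
  fixes s :: nat
  assumes sch: "schramm_sequence \<phi>" and q: "1 \<le> q" and M: "0 < M"
    and hyp: "\<And>k. k \<in> {1..s} \<Longrightarrow> 1 \<le> schramm_sum \<phi> k (M * real k powr (-1 / q))"
    and x0: "\<And>i. 0 \<le> x i" and xmono: "\<And>i. i \<in> {1..s} \<Longrightarrow> x (Suc i) \<le> x i" and xs: "x (Suc s) = 0"
    and le1: "(\<Sum>j=1..s. \<phi> j (x j)) \<le> 1"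
  shows "(\<Sum>j=1..s. x j powr q) powr (1 / q) \<le> 6 * M"
proof (cases "s = 0")
  case True
  then show ?thesis using M by simp
next
  case False
  define w where "w i = max ((x i / M) powr q) (1 / s)" for i
  have mono: "x j \<le> x i" if "i \<le> j" "j \<in> {1..s}" "1 \<le> i" for i j
    using that(1,2)
  proof (induction j rule: dec_induct)
    case (step n)
    then show ?case using xmono[of n] that(3) by simp
  qed simp
  \<comment> \<open>The weak bound: the first i terms all have arguments at least x i.\<close>
  have xle: "x i \<le> M * real i powr (-1 / q)" if i: "i \<in> {1..s}" for i
  proof (rule ccontr)
    assume "\<not> ?thesis"
    then have "1 < schramm_sum \<phi> i (x i)"
      using hyp[OF i] schramm_sum_strict_mono[OF sch, of i "M * real i powr (-1 / q)" "x i"] i M by force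
    also have "\<dots> \<le> (\<Sum>j=1..i. \<phi> j (x j))"
      unfolding schramm_sum_def using i mono x0 by (intro sum_mono schramm_term_mono[OF sch]) auto
    also have "\<dots> \<le> (\<Sum>j=1..s. \<phi> j (x j))"
      using i x0 by (intro sum_mono2 schramm_term_nonneg[OF sch]) auto
    finally show False using le1 by simp
  qed
  have "(\<Sum>i=1..s. w i) - 1 = (\<Sum>i=1..s. real i * (w i - w (Suc i)))"
    using abel_summation[of "\<lambda>_ y. y" w s] False xs M
    by (simp add: algebra_simps w_def)
  also have "\<dots> \<le> (\<Sum>i=1..s. 2 * q * (schramm_sum \<phi> i (x i) - schramm_sum \<phi> i (x (Suc i))))"
    unfolding w_def using xmono x0 xle
    by (intro sum_mono schramm_sum_increment_ge[OF sch q M hyp]) auto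
  also have "\<dots> = 2 * q * ((\<Sum>i=1..s. \<phi> i (x i)) - schramm_sum \<phi> s 0)"
    using abel_summation[of \<phi> x s] by (simp add: schramm_sum_def xs flip: sum_distrib_left)
  also have "\<dots> \<le> 2 * q * 1"
    using le1 q schramm_sum_nonneg[OF sch, of 0 s] by (intro mult_left_mono) auto
  finally have "(\<Sum>i=1..s. w i) \<le> 2 * q + 1" by simp
  moreover have "(\<Sum>i=1..s. (x i / M) powr q) \<le> (\<Sum>i=1..s. w i)"
    unfolding w_def by (intro sum_mono) auto
  moreover have "(\<Sum>i=1..s. (x i / M) powr q) = (\<Sum>i=1..s. x i powr q) / M powr q"
    using M x0 by (simp add: powr_divide sum_divide_distrib)
  ultimately have "(\<Sum>i=1..s. x i powr q) / M powr q \<le> 3 * q"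
    using q by linarith
  then have "(\<Sum>i=1..s. x i powr q) \<le> 3 * q * M powr q"
    using M by (simp add: field_simps)
  also have "\<dots> \<le> 6 powr q * M powr q"
  proof (intro mult_right_mono)
    have "3 * q \<le> 3 powr q * 2 powr q"
    proof (intro mult_mono)
      show "3 \<le> 3 powr q" using powr_mono[of 1 q 3] q by simp
      have "1 powr q - 2 powr q \<le> q * (1 - 2 / 1) * 1 powr q"
        using q by (intro powr_secant_le) auto
      then show "q \<le> 2 powr q" by simp
    qed (use q in auto)
    then show "3 * q \<le> 6 powr q" by (simp flip: powr_mult)
  qed auto
  also have "\<dots> = (6 * M) powr q" using M by (simp add: powr_mult)
  finally have "(\<Sum>i=1..s. x i powr q) powr (1 / q) \<le> ((6 * M) powr q) powr (1 / q)"
    using q x0 by (intro powr_mono2) (auto intro: sum_nonneg)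
  then show ?thesis using q M by (simp add: powr_powr)
qed

section \<open>Counting nonoverlapping intervals\<close>

lemma open_interval_subset_interior:
  fixes I :: "real set"
  assumes "is_interval I" "I \<noteq> {}" "I \<subseteq> {0..1}"
  shows "{Inf I<..<Sup I} \<subseteq> interior I" "0 \<le> Inf I" "Inf I \<le> Sup I" "Sup I \<le> 1"
proof -
  have bdd: "bdd_below I" "bdd_above I"
    using assms(3) by (auto intro: bdd_below_mono bdd_above_mono)
  have "z \<in> I" if z: "Inf I < z" "z < Sup I" for z
  proof -
    obtain x y where "x \<in> I" "x < z" "y \<in> I" "z < y"
      using z cInf_lessD[of I z] less_cSupD[of I z] assms(2) by blast
    then show ?thesis
      using assms(1) unfolding is_interval_1 by (meson less_imp_le)
  qed
  then show "{Inf I<..<Sup I} \<subseteq> interior I" by (intro interior_maximal) auto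
  show "0 \<le> Inf I" using assms by (intro cInf_greatest) auto
  show "Sup I \<le> 1" using assms by (intro cSup_least) auto
  show "Inf I \<le> Sup I" using assms bdd by (intro cInf_le_cSup)
qed

lemma nonoverlapping_disjoint_open:
  assumes "nonoverlapping_intervals s I" "i \<in> {1..s}" "j \<in> {1..s}" "i \<noteq> j"
  shows "{Inf (I i)<..<Sup (I i)} \<inter> {Inf (I j)<..<Sup (I j)} = {}"
proof -
  have "interior (I i) \<inter> interior (I j) = {}"
    using assms unfolding nonoverlapping_intervals_def disjoint_family_on_def by blast
  moreover have "{Inf (I k)<..<Sup (I k)} \<subseteq> interior (I k)" if "k \<in> {1..s}" for k
    using assms(1) that unfolding nonoverlapping_intervals_def
    by (intro open_interval_subset_interior) auto
  ultimately show ?thesis using assms(2,3) by blast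
qed

text \<open>The interiors are disjoint subsets of the unit interval, so their lengths add up to at most \<open>1\<close>.\<close>

lemma card_long_nonoverlapping_le:
  assumes no: "nonoverlapping_intervals s I" and d: "0 < d"
    and len: "\<And>j. j \<in> {1..s} \<Longrightarrow> 1 / d \<le> interval_length (I j)"
  shows "real s \<le> d"
proof -
  let ?U = "\<lambda>j. {Inf (I j)<..<Sup (I j)}"
  have I: "0 \<le> Inf (I j)" "Inf (I j) \<le> Sup (I j)" "Sup (I j) \<le> 1" if "j \<in> {1..s}" for j
    using no that open_interval_subset_interior[of "I j"]
    unfolding nonoverlapping_intervals_def by auto
  have "real s * (1 / d) = (\<Sum>j=1..s. 1 / d)" by simp
  also have "\<dots> \<le> (\<Sum>j=1..s. measure lborel (?U j))"
    using len I by (intro sum_mono) (auto simp: interval_length_def)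
  also have "\<dots> = measure lborel (\<Union>j\<in>{1..s}. ?U j)"
  proof (rule measure_finite_Union[symmetric])
    show "disjoint_family_on ?U {1..s}"
      unfolding disjoint_family_on_def using nonoverlapping_disjoint_open[OF no] by blast
    show "emeasure lborel (?U j) \<noteq> \<infinity>" if "j \<in> {1..s}" for j
      using I[OF that] by simp
  qed auto
  also have "\<dots> \<le> measure lborel {0..1::real}"
  proof (rule measure_mono_fmeasurable)
    show "(\<Union>j\<in>{1..s}. ?U j) \<subseteq> {0..1}"
    proof (clarify)
      fix j x assume "j \<in> {1..s}" "x \<in> ?U j"
      with I[of j] show "x \<in> {0..1}" by auto
    qed
  qed (auto simp: fmeasurable_def)
  finally show ?thesis using d by (simp add: field_simps)
qed

text \<open>A point can be the left endpoint of only one nondegenerate interval of the family, and the right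
  endpoint of only one: two such intervals would share interior points.\<close>

lemma card_intervals_with_endpoint_in_le:
  assumes no: "nonoverlapping_intervals s I" and S: "finite S"
  shows "card {j \<in> {1..s}. Inf (I j) < Sup (I j) \<and> (Inf (I j) \<in> S \<or> Sup (I j) \<in> S)} \<le> 2 * card S"
proof -
  let ?N = "{j \<in> {1..s}. Inf (I j) < Sup (I j)}"
  let ?L = "{j \<in> ?N. Inf (I j) \<in> S}" and ?R = "{j \<in> ?N. Sup (I j) \<in> S}"
  have disj: "{Inf (I i)<..<Sup (I i)} \<inter> {Inf (I j)<..<Sup (I j)} = {}"
    if "i \<in> ?N" "j \<in> ?N" "i \<noteq> j" for i j
    using that by (intro nonoverlapping_disjoint_open[OF no]) auto
  have "inj_on (\<lambda>j. Inf (I j)) ?N"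
  proof (rule inj_onI, rule ccontr)
    fix i j assume ij: "i \<in> ?N" "j \<in> ?N" "Inf (I i) = Inf (I j)" "i \<noteq> j"
    obtain z where "Inf (I i) < z" "z < min (Sup (I i)) (Sup (I j))"
      using ij dense[of "Inf (I i)" "min (Sup (I i)) (Sup (I j))"] by auto
    then show False using disj[of i j] ij by auto
  qed
  then have "card ?L \<le> card S"
    using S by (intro card_inj_on_le[of "\<lambda>j. Inf (I j)"]) (auto simp: inj_on_def)
  moreover have "inj_on (\<lambda>j. Sup (I j)) ?N"
  proof (rule inj_onI, rule ccontr)
    fix i j assume ij: "i \<in> ?N" "j \<in> ?N" "Sup (I i) = Sup (I j)" "i \<noteq> j"
    obtain z where "max (Inf (I i)) (Inf (I j)) < z" "z < Sup (I i)"
      using ij dense[of "max (Inf (I i)) (Inf (I j))" "Sup (I i)"] by auto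
    then show False using disj[of i j] ij by auto
  qed
  then have "card ?R \<le> card S"
    using S by (intro card_inj_on_le[of "\<lambda>j. Sup (I j)"]) (auto simp: inj_on_def)
  moreover have "{j \<in> {1..s}. Inf (I j) < Sup (I j) \<and> (Inf (I j) \<in> S \<or> Sup (I j) \<in> S)} = ?L \<union> ?R"
    by auto
  ultimately show ?thesis using card_Un_le[of ?L ?R] by simp
qed

section \<open>Sufficiency of the growth condition\<close>

lemma ex_decreasing_rearrangement:
  fixes a :: "nat \<Rightarrow> real"
  shows "\<exists>p. bij_betw p {1..s} {1..s} \<and> (\<forall>i\<in>{1..s}. \<forall>j\<in>{1..s}. i \<le> j \<longrightarrow> a (p j) \<le> a (p i))"
proof -
  define xs where "xs = sort_key (\<lambda>j. - a j) [1..<Suc s]"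
  have len: "length xs = s" by (simp add: xs_def)
  have "bij_betw ((!) xs) {..<s} {1..s}"
    by (rule bij_betw_nth) (auto simp: xs_def)
  moreover have "bij_betw (\<lambda>i. i - 1) {1..s} {..<s}"
    by (rule bij_betw_byWitness[of _ Suc]) auto
  ultimately have "bij_betw (\<lambda>i. xs ! (i - 1)) {1..s} {1..s}"
    using bij_betw_trans[of "\<lambda>i. i - 1" "{1..s}" "{..<s}" "(!) xs"] by (simp add: o_def)
  moreover have "a (xs ! (j - 1)) \<le> a (xs ! (i - 1))" if "i \<in> {1..s}" "j \<in> {1..s}" "i \<le> j" for i j
  proof -
    have "sorted (map (\<lambda>j. - a j) xs)" by (simp add: xs_def)
    from sorted_nth_mono[OF this, of "i - 1" "j - 1"] show ?thesis using that len by auto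
  qed
  ultimately show ?thesis by (intro exI[of _ "\<lambda>i. xs ! (i - 1)"]) blast
qed

lemma nonoverlapping_intervals_permute:
  assumes "nonoverlapping_intervals s I" "bij_betw p {1..s} {1..s}"
  shows "nonoverlapping_intervals s (\<lambda>i. I (p i))"
proof -
  have p: "p ` {1..s} = {1..s}" "inj_on p {1..s}" using assms(2) by (auto simp: bij_betw_def)
  have dis: "interior (I k) \<inter> interior (I l) = {}" if "k \<in> {1..s}" "l \<in> {1..s}" "k \<noteq> l" for k l
    using assms(1) that unfolding nonoverlapping_intervals_def disjoint_family_on_def by blast
  have mem: "p i \<in> {1..s}" if "i \<in> {1..s}" for i using p(1) that by blast
  have "disjoint_family_on (\<lambda>i. interior (I (p i))) {1..s}"
    unfolding disjoint_family_on_def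
    using dis[OF mem mem] inj_on_contraD[OF p(2)] by blast
  then show ?thesis
    using assms(1) mem unfolding nonoverlapping_intervals_def by blast
qed

lemma schramm_sum_le_variation:
  assumes "schramm_variation \<phi> g \<le> ereal V" "nonoverlapping_intervals s I"
  shows "(\<Sum>j=1..s. \<phi> j \<bar>interval_incr g (I j)\<bar>) \<le> V"
proof -
  have "ereal (\<Sum>j=1..s. \<phi> j \<bar>interval_incr g (I j)\<bar>) \<le> schramm_variation \<phi> g"
    unfolding schramm_variation_def using assms(2) by (intro SUP_upper2[of "(s, I)"]) auto
  then show ?thesis using assms(1) by (metis ereal_less_eq(3) order_trans)
qed

lemma interval_incr_scale: "interval_incr (\<lambda>x. c * f x) I = c * interval_incr f I"
  by (simp add: interval_incr_def algebra_simps)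

text \<open>The variation is not homogeneous, but convexity still lets a scaling of the function normalise it.\<close>

lemma schramm_variation_scale_le_one:
  assumes sch: "schramm_sequence \<phi>" and V: "schramm_variation \<phi> g \<le> ereal V" "1 \<le> V"
  shows "schramm_variation \<phi> (\<lambda>x. 1 / V * g x) \<le> ereal 1"
  unfolding schramm_variation_def
proof (intro SUP_least, clarify)
  fix s I assume no: "nonoverlapping_intervals s I"
  have "(\<Sum>j=1..s. \<phi> j \<bar>interval_incr (\<lambda>x. 1 / V * g x) (I j)\<bar>)
      \<le> (\<Sum>j=1..s. 1 / V * \<phi> j \<bar>interval_incr g (I j)\<bar>)"
  proof (intro sum_mono)
    fix j assume j: "j \<in> {1..s}"
    have "\<phi> j \<bar>interval_incr (\<lambda>x. 1 / V * g x) (I j)\<bar> = \<phi> j (1 / V * \<bar>interval_incr g (I j)\<bar>)"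
      unfolding interval_incr_scale abs_mult using V(2) by simp
    also have "\<dots> \<le> 1 / V * \<phi> j \<bar>interval_incr g (I j)\<bar>"
      using j V(2) by (intro schramm_term_scale_le[OF sch]) auto
    finally show "\<phi> j \<bar>interval_incr (\<lambda>x. 1 / V * g x) (I j)\<bar> \<le> 1 / V * \<phi> j \<bar>interval_incr g (I j)\<bar>" .
  qed
  also have "\<dots> = 1 / V * (\<Sum>j=1..s. \<phi> j \<bar>interval_incr g (I j)\<bar>)"
    by (simp add: sum_distrib_left)
  also have "\<dots> \<le> 1 / V * V"
    using schramm_sum_le_variation[OF V(1) no] V(2) by (intro mult_left_mono) auto
  finally show "ereal (\<Sum>j=1..s. \<phi> j \<bar>interval_incr (\<lambda>x. 1 / V * g x) (I j)\<bar>) \<le> ereal 1"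
    using V(2) by simp
qed

text \<open>Since the variation admits the intervals in any order, they may be numbered so that the
  increments decrease, as the bound on power sums requires.\<close>

lemma power_sum_of_increments_le:
  assumes sch: "schramm_sequence \<phi>" and q: "1 \<le> q" and d: "0 < d" and M: "0 < M"
    and bound: "\<And>k. 1 \<le> k \<Longrightarrow> real k \<le> d \<Longrightarrow> real k powr (1 / q) * schramm_sum_inv \<phi> k 1 \<le> M"
    and var: "schramm_variation \<phi> g \<le> ereal 1"
    and no: "nonoverlapping_intervals s I"
    and len: "\<And>j. j \<in> {1..s} \<Longrightarrow> 1 / d \<le> interval_length (I j)"
  shows "(\<Sum>j=1..s. \<bar>interval_incr g (I j)\<bar> powr q) powr (1 / q) \<le> 6 * M"
proof -
  define a where "a j = \<bar>interval_incr g (I j)\<bar>" for j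
  obtain p where p: "bij_betw p {1..s} {1..s}"
    and p_mono: "\<And>i j. i \<in> {1..s} \<Longrightarrow> j \<in> {1..s} \<Longrightarrow> i \<le> j \<Longrightarrow> a (p j) \<le> a (p i)"
    using ex_decreasing_rearrangement[of s a] by blast
  \<comment> \<open>The value 0 past the end terminates the Abel summation.\<close>
  define x where "x i = (if i \<in> {1..s} then a (p i) else 0)" for i
  have sd: "real s \<le> d" using card_long_nonoverlapping_le[OF no d len] .
  have "(\<Sum>j=1..s. x j powr q) powr (1 / q) \<le> 6 * M"
  proof (rule sum_powr_le_of_sum_schramm_le_one[OF sch q M])
    fix k assume k: "k \<in> {1..s}"
    have "real k powr (1 / q) * schramm_sum_inv \<phi> k 1 \<le> M" using k sd by (intro bound) auto
    then have "schramm_sum_inv \<phi> k 1 \<le> M * real k powr (-1 / q)"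
      using k by (simp add: powr_minus_divide field_simps)
    then have "schramm_sum \<phi> k (schramm_sum_inv \<phi> k 1) \<le> schramm_sum \<phi> k (M * real k powr (-1 / q))"
      using schramm_sum_inv_one[OF sch, of k] k by (intro schramm_sum_mono[OF sch]) auto
    then show "1 \<le> schramm_sum \<phi> k (M * real k powr (-1 / q))"
      using schramm_sum_inv_one[OF sch, of k] k by auto
  next
    show "0 \<le> x i" for i by (simp add: x_def a_def)
    show "x (Suc i) \<le> x i" if "i \<in> {1..s}" for i
      using p_mono[of i "Suc i"] that by (auto simp: x_def a_def)
    have "(\<Sum>j=1..s. \<phi> j (x j)) = (\<Sum>j=1..s. \<phi> j \<bar>interval_incr g (I (p j))\<bar>)"
      by (intro sum.cong) (auto simp: x_def a_def)
    also have "\<dots> \<le> 1"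
      by (rule schramm_sum_le_variation[OF var nonoverlapping_intervals_permute[OF no p]])
    finally show "(\<Sum>j=1..s. \<phi> j (x j)) \<le> 1" .
  qed (simp add: x_def)
  moreover have "(\<Sum>j=1..s. x j powr q) = (\<Sum>j=1..s. a (p j) powr q)"
    by (intro sum.cong) (auto simp: x_def)
  moreover have "\<dots> = (\<Sum>j=1..s. a j powr q)"
    by (rule sum.reindex_bij_betw[OF p])
  ultimately show ?thesis by (simp add: a_def)
qed

lemma Phi_BV_subset_BV_seq:
  assumes sch: "schramm_sequence \<phi>" and q: "\<And>n. n \<ge> 1 \<Longrightarrow> 1 \<le> q n"
    and \<delta>: "\<And>n. n \<ge> 1 \<Longrightarrow> 0 < \<delta> n" and M: "0 < M"
    and bound: "\<And>n k. 1 \<le> n \<Longrightarrow> 1 \<le> k \<Longrightarrow> real k \<le> \<delta> n \<Longrightarrow>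
                  real k powr (1 / q n) * schramm_sum_inv \<phi> k 1 \<le> M"
  shows "Phi_BV \<phi> \<subseteq> BV_seq q \<delta>"
proof
  fix f assume "f \<in> Phi_BV \<phi>"
  then obtain c where c: "c > 0" and fin: "schramm_variation \<phi> (\<lambda>x. c * f x) < \<infinity>"
    by (auto simp: Phi_BV_def)
  obtain V where V: "schramm_variation \<phi> (\<lambda>x. c * f x) \<le> ereal V" "1 \<le> V"
  proof (cases "schramm_variation \<phi> (\<lambda>x. c * f x)")
    case (real v)
    then show ?thesis using that[of "max 1 v"] by simp
  next
    case MInf
    then show ?thesis using that[of 1] by simp
  qed (use fin in simp)
  define r where "r = 1 / V * c"
  have r: "r > 0" using c V by (simp add: r_def)
  have var: "schramm_variation \<phi> (\<lambda>x. r * f x) \<le> ereal 1"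
    using schramm_variation_scale_le_one[OF sch V] by (simp add: r_def)
  have "q_variation (q n) (\<delta> n) f \<le> ereal (6 * M / r)" if n: "n \<ge> 1" for n
    unfolding q_variation_def
  proof (intro SUP_least, clarify)
    fix s I assume no: "nonoverlapping_intervals s I"
      and len: "\<forall>j\<in>{1..s}. 1 / \<delta> n \<le> interval_length (I j)"
    let ?S = "\<Sum>j=1..s. \<bar>interval_incr f (I j)\<bar> powr q n"
    have "(\<Sum>j=1..s. \<bar>interval_incr (\<lambda>x. r * f x) (I j)\<bar> powr q n) powr (1 / q n) \<le> 6 * M"
      using n len by (intro power_sum_of_increments_le[OF sch q \<delta> M bound var no]) auto
    also have "(\<Sum>j=1..s. \<bar>interval_incr (\<lambda>x. r * f x) (I j)\<bar> powr q n) = r powr q n * ?S"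
      unfolding interval_incr_scale abs_mult using r by (simp add: powr_mult sum_distrib_left)
    also have "(r powr q n * ?S) powr (1 / q n) = r * ?S powr (1 / q n)"
      using r q[OF n] by (simp add: powr_mult powr_powr sum_nonneg)
    finally show "ereal (?S powr (1 / q n)) \<le> ereal (6 * M / r)"
      using r by (simp add: field_simps)
  qed
  then have "(SUP n\<in>{1..}. q_variation (q n) (\<delta> n) f) \<le> ereal (6 * M / r)"
    by (intro SUP_least) auto
  then show "f \<in> BV_seq q \<delta>" by (auto simp: BV_seq_def)
qed

section \<open>Necessity of the growth condition\<close>

text \<open>The blocks of points may meet; the first block containing a point decides its height. For
  decreasing heights this is the largest height available, so no spike is lowered by other blocks.\<close>

definition spikes :: "(nat \<Rightarrow> real set) \<Rightarrow> (nat \<Rightarrow> real) \<Rightarrow> real \<Rightarrow> real" where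
  "spikes S b x = (if \<exists>i. x \<in> S i then b (LEAST i. x \<in> S i) else 0)"

lemma spikes_cases:
  assumes "spikes S b x \<noteq> 0"
  obtains i where "x \<in> S i" "spikes S b x = b i"
  using assms unfolding spikes_def by (metis LeastI_ex)

lemma spikes_ge:
  assumes "antimono b" "x \<in> S i"
  shows "b i \<le> spikes S b x"
proof -
  have "b i \<le> b (LEAST i. x \<in> S i)"
    using assms(2) by (intro antimonoD[OF assms(1)] Least_le)
  then show ?thesis using assms(2) by (auto simp: spikes_def)
qed

text \<open>Each nonzero increment is at most the height of one block \<open>\<iota> j\<close> having a point at an endpoint of
  the interval. Grouping the intervals by \<open>\<iota>\<close>, a block occurs at most \<open>2 * card (S i)\<close> times, and
  the factors \<open>(1 / 2) ^ i\<close> come out of the \<open>\<phi>\<^sub>j\<close> by convexity, leaving a geometric series.\<close>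

lemma spikes_variation_le:
  assumes sch: "schramm_sequence \<phi>" and S: "\<And>i. finite (S i)" and A: "\<And>i. 0 \<le> A i"
    and small: "\<And>i. schramm_sum \<phi> (2 * card (S i)) (A i) \<le> 2"
  shows "schramm_variation \<phi> (spikes S (\<lambda>i. (1 / 2) ^ i * A i)) \<le> ereal 4"
  unfolding schramm_variation_def
proof (intro SUP_least, clarify)
  fix s I assume no: "nonoverlapping_intervals s I"
  define b where "b = (\<lambda>i. (1 / 2) ^ i * A i)"
  define f where "f = spikes S b"
  define J where "J = {j \<in> {1..s}. interval_incr f (I j) \<noteq> 0}"
  have b0: "0 \<le> b i" for i using A by (simp add: b_def)
  have f0: "0 \<le> f x" for x by (simp add: f_def spikes_def b0)
  have "\<exists>i. \<bar>interval_incr f (I j)\<bar> \<le> b i \<and> (Inf (I j) \<in> S i \<or> Sup (I j) \<in> S i)" if "j \<in> J" for j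
  proof (cases "f (Inf (I j)) \<le> f (Sup (I j))")
    case True
    then have "spikes S b (Sup (I j)) \<noteq> 0"
      using that f0[of "Inf (I j)"] by (auto simp: J_def interval_incr_def f_def[symmetric])
    then obtain i where "Sup (I j) \<in> S i" "f (Sup (I j)) = b i" unfolding f_def by (rule spikes_cases)
    then show ?thesis
      using True f0[of "Inf (I j)"] by (intro exI[of _ i]) (auto simp: interval_incr_def)
  next
    case False
    then have "spikes S b (Inf (I j)) \<noteq> 0"
      using f0[of "Sup (I j)"] by (auto simp: f_def[symmetric])
    then obtain i where "Inf (I j) \<in> S i" "f (Inf (I j)) = b i" unfolding f_def by (rule spikes_cases)
    then show ?thesis
      using False f0[of "Sup (I j)"] by (intro exI[of _ i]) (auto simp: interval_incr_def)
  qed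
  then obtain \<iota> where \<iota>: "\<And>j. j \<in> J \<Longrightarrow> \<bar>interval_incr f (I j)\<bar> \<le> b (\<iota> j)"
      "\<And>j. j \<in> J \<Longrightarrow> Inf (I j) \<in> S (\<iota> j) \<or> Sup (I j) \<in> S (\<iota> j)"
    by metis
  have J: "finite J" "J \<subseteq> {1..s}" by (auto simp: J_def)
  have nondeg: "Inf (I j) < Sup (I j)" if "j \<in> J" for j
  proof -
    have "Inf (I j) \<le> Sup (I j)"
      using no that open_interval_subset_interior(3)[of "I j"]
      by (auto simp: J_def nonoverlapping_intervals_def)
    moreover have "Inf (I j) \<noteq> Sup (I j)" using that by (auto simp: J_def interval_incr_def)
    ultimately show ?thesis by simp
  qed
  have block: "(\<Sum>j\<in>{j\<in>J. \<iota> j = i}. \<phi> j (A i)) \<le> 2" for i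
  proof -
    have "(\<Sum>j\<in>{j\<in>J. \<iota> j = i}. \<phi> j (A i)) \<le> schramm_sum \<phi> (card {j\<in>J. \<iota> j = i}) (A i)"
      using J A by (intro schramm_sum_over_subset_le[OF sch]) auto
    also have "\<dots> \<le> schramm_sum \<phi> (2 * card (S i)) (A i)"
    proof (intro schramm_sum_mono_index[OF sch] A)
      have "card {j\<in>J. \<iota> j = i}
          \<le> card {j \<in> {1..s}. Inf (I j) < Sup (I j) \<and> (Inf (I j) \<in> S i \<or> Sup (I j) \<in> S i)}"
        using \<iota>(2) nondeg J by (intro card_mono) auto
      also have "\<dots> \<le> 2 * card (S i)"
        by (rule card_intervals_with_endpoint_in_le[OF no S])
      finally show "card {j\<in>J. \<iota> j = i} \<le> 2 * card (S i)" .
    qed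
    finally show ?thesis using small[of i] by linarith
  qed
  have "(\<Sum>j=1..s. \<phi> j \<bar>interval_incr f (I j)\<bar>) = (\<Sum>j\<in>J. \<phi> j \<bar>interval_incr f (I j)\<bar>)"
    using sch by (intro sum.mono_neutral_right) (auto simp: J_def schramm_sequence_def)
  also have "\<dots> \<le> (\<Sum>j\<in>J. (1 / 2) ^ \<iota> j * \<phi> j (A (\<iota> j)))"
  proof (rule sum_mono)
    fix j assume j: "j \<in> J"
    then have j1: "1 \<le> j" using J by auto
    have "\<phi> j \<bar>interval_incr f (I j)\<bar> \<le> \<phi> j ((1 / 2) ^ \<iota> j * A (\<iota> j))"
      using \<iota>(1)[OF j] by (intro schramm_term_mono[OF sch j1]) (auto simp: b_def)
    also have "\<dots> \<le> (1 / 2) ^ \<iota> j * \<phi> j (A (\<iota> j))"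
      using A by (intro schramm_term_scale_le[OF sch j1]) (auto simp: power_le_one)
    finally show "\<phi> j \<bar>interval_incr f (I j)\<bar> \<le> (1 / 2) ^ \<iota> j * \<phi> j (A (\<iota> j))" .
  qed
  also have "\<dots> = (\<Sum>i\<in>\<iota> ` J. \<Sum>j\<in>{j\<in>J. \<iota> j = i}. (1 / 2) ^ \<iota> j * \<phi> j (A (\<iota> j)))"
    by (rule sum.image_gen[OF J(1)])
  also have "\<dots> = (\<Sum>i\<in>\<iota> ` J. (1 / 2) ^ i * (\<Sum>j\<in>{j\<in>J. \<iota> j = i}. \<phi> j (A i)))"
    by (intro sum.cong) (auto simp: sum_distrib_left)
  also have "\<dots> \<le> (\<Sum>i\<in>\<iota> ` J. (1 / 2) ^ i * 2)"
    using block by (intro sum_mono mult_left_mono) auto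
  also have "\<dots> = 2 * (\<Sum>i\<in>\<iota> ` J. (1 / 2) ^ i)"
    by (simp add: sum_distrib_left mult.commute)
  also have "\<dots> \<le> 2 * (\<Sum>i. (1 / 2) ^ i)"
    using J(1) by (intro mult_left_mono sum_le_suminf) (auto intro: summable_geometric)
  also have "\<dots> = 4" by (simp add: suminf_geometric)
  finally show "ereal (\<Sum>j=1..s. \<phi> j \<bar>interval_incr (spikes S (\<lambda>i. (1 / 2) ^ i * A i)) (I j)\<bar>) \<le> ereal 4"
    by (simp add: f_def b_def)
qed

lemma exists_small_irrational:
  assumes "0 < (\<epsilon>::real)"
  shows "\<exists>\<theta>. 0 < \<theta> \<and> \<theta> < \<epsilon> \<and> \<theta> \<notin> \<rat>"
proof (rule ccontr)
  assume "\<not> ?thesis"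
  then have "{0<..<\<epsilon>} \<subseteq> \<rat>" by auto
  then show False
    using assms uncountable_open_interval[of 0 \<epsilon>] countable_subset[OF _ countable_rat] by blast
qed

text \<open>The intervals run from the shifted left ends to the right ends of the \<open>m\<close> equal cells of the unit
  interval.\<close>

lemma q_variation_ge_on_shifted_grid:
  fixes m :: nat
  assumes q: "1 \<le> q" and d: "0 < d" and m: "1 \<le> m" and \<theta>: "0 < \<theta>" "\<theta> \<le> 1 / m - 1 / d"
    and b: "0 \<le> b"
    and f: "\<And>j. j \<in> {1..m} \<Longrightarrow> b \<le> \<bar>f (real j / m) - f ((real j - 1) / m + \<theta>)\<bar>"
  shows "ereal (real m powr (1 / q) * b) \<le> q_variation q d f"
proof -
  define I where "I j = {(real j - 1) / m + \<theta>..real j / m}" for j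
  have d1: "0 < 1 / d" using d by simp
  have le: "(real j - 1) / m + \<theta> < real j / m" for j
    unfolding diff_divide_distrib using \<theta> d1 by linarith
  have IS: "Inf (I j) = (real j - 1) / m + \<theta>" "Sup (I j) = real j / m" for j
    using le[of j] by (auto simp: I_def)
  have dis: "{(real i - 1) / m + \<theta><..<real i / m} \<inter> {(real j - 1) / m + \<theta><..<real j / m} = {}" if "i < j" for i j :: nat
  proof -
    have "real i / m \<le> (real j - 1) / m" using that by (intro divide_right_mono) auto
    then show ?thesis using \<theta>(1) by auto
  qed
  have no: "nonoverlapping_intervals m I"
    unfolding nonoverlapping_intervals_def
  proof
    show "\<forall>j\<in>{1..m}. is_interval (I j) \<and> I j \<noteq> {} \<and> I j \<subseteq> {0..1}"
    proof
      fix j assume j: "j \<in> {1..m}"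
      have "0 \<le> (real j - 1) / m" "real j / m \<le> 1" using j by auto
      then show "is_interval (I j) \<and> I j \<noteq> {} \<and> I j \<subseteq> {0..1}"
        using le[of j] \<theta>(1) unfolding I_def by (auto simp: is_interval_cc)
    qed
    show "disjoint_family_on (\<lambda>j. interior (I j)) {1..m}"
      unfolding disjoint_family_on_def I_def interior_atLeastAtMost_real
      using dis by (metis inf_commute linorder_neqE_nat)
  qed
  have len: "\<forall>j\<in>{1..m}. interval_length (I j) \<ge> 1 / d"
    using \<theta> by (auto simp: interval_length_def IS diff_divide_distrib)
  have "real m powr (1 / q) * b = (\<Sum>j=1..m. b powr q) powr (1 / q)"
    using q b by (simp add: powr_mult powr_powr)
  also have "\<dots> \<le> (\<Sum>j=1..m. \<bar>interval_incr f (I j)\<bar> powr q) powr (1 / q)"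
    using q b f unfolding interval_incr_def IS
    by (intro powr_mono2 sum_mono sum_nonneg) auto
  finally show ?thesis
    unfolding q_variation_def using no len
    by (intro SUP_upper2[of "(m, I)"]) auto
qed

text \<open>The block sizes \<open>k i\<close> can be made increasing because \<open>k powr (1 / q) * A k \<le> k * A 1\<close>: large
  values force large \<open>k\<close>. The intended \<open>A k\<close> decreases in \<open>k\<close>, so the spike heights will decrease.\<close>

lemma exists_unbounded_blocks:
  fixes A q \<delta> :: "nat \<Rightarrow> real"
  assumes q: "\<And>n. n \<ge> 1 \<Longrightarrow> 1 \<le> q n" and A: "0 < A 1" "\<And>k. 1 \<le> k \<Longrightarrow> A k \<le> A 1"
    and unbounded: "\<And>C. \<exists>n\<ge>1. \<exists>k\<ge>1. real k \<le> \<delta> n \<and> C < real k powr (1 / q n) * A k"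
  shows "\<exists>n k :: nat \<Rightarrow> nat. (\<forall>i. 1 \<le> n i \<and> 1 \<le> k i \<and> real (k i) \<le> \<delta> (n i) \<and>
           4 ^ i \<le> real (k i) powr (1 / q (n i)) * A (k i)) \<and> incseq k"
proof -
  define P where "P i x \<longleftrightarrow> 1 \<le> fst x \<and> 1 \<le> snd x \<and> real (snd x) \<le> \<delta> (fst x) \<and>
    4 ^ i \<le> real (snd x) powr (1 / q (fst x)) * A (snd x)" for i :: nat and x :: "nat \<times> nat"
  have step: "\<exists>y. P i y \<and> K \<le> snd y" for i K
  proof -
    obtain n k where nk: "n \<ge> 1" "k \<ge> 1" "real k \<le> \<delta> n"
      "max (4 ^ i) (real K * A 1) < real k powr (1 / q n) * A k"
      using unbounded by blast
    note nk(4)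
    also have "real k powr (1 / q n) * A k \<le> real k powr (1 / q n) * A 1"
      using nk A by (intro mult_left_mono) auto
    also have "\<dots> \<le> real k powr 1 * A 1"
      using nk q[of n] A by (intro mult_right_mono powr_mono) auto
    finally have "real K * A 1 < real k * A 1" by simp
    then have "K \<le> k" using A(1) by (simp add: mult_less_cancel_right)
    then show ?thesis using nk by (intro exI[of _ "(n, k)"]) (auto simp: P_def)
  qed
  have "\<exists>x. \<forall>i. P i (x i) \<and> snd (x i) \<le> snd (x (Suc i))"
    using step by (intro dependent_nat_choice) blast+
  then obtain x where x: "\<And>i. P i (x i)" "\<And>i. snd (x i) \<le> snd (x (Suc i))" by blast
  have "incseq (\<lambda>i. snd (x i))" by (rule incseq_SucI) (rule x(2))
  then show ?thesis
    using x(1) unfolding P_def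
    by (intro exI[of _ "\<lambda>i. fst (x i)"] exI[of _ "\<lambda>i. snd (x i)"]) blast
qed

text \<open>The witness has spikes of height \<open>(1 / 2) ^ i * A\<^sub>k\<close> with \<open>k = k i\<close>, one in each of \<open>m i\<close> equal cells.
  The norm \<open>4 ^ i\<close> available in block \<open>i\<close> absorbs the damping \<open>(1 / 2) ^ i\<close> and still tends to
  infinity.\<close>

lemma not_Phi_BV_subset_BV_seq:
  assumes sch: "schramm_sequence \<phi>" and q: "\<And>n. n \<ge> 1 \<Longrightarrow> 1 \<le> q n"
    and \<delta>: "\<And>n. n \<ge> 1 \<Longrightarrow> 1 < \<delta> n"
    and unbounded: "\<And>C. \<exists>n\<ge>1. \<exists>k\<ge>1. real k \<le> \<delta> n \<and>
                     C < real k powr (1 / q n) * schramm_sum_inv \<phi> k 1"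
  shows "\<not> Phi_BV \<phi> \<subseteq> BV_seq q \<delta>"
proof
  assume sub: "Phi_BV \<phi> \<subseteq> BV_seq q \<delta>"
  let ?A = "\<lambda>k. schramm_sum_inv \<phi> k 1"
  obtain n k :: "nat \<Rightarrow> nat" where n: "\<And>i. 1 \<le> n i" and k: "\<And>i. 1 \<le> k i"
    and k\<delta>: "\<And>i. real (k i) \<le> \<delta> (n i)"
    and big: "\<And>i. 4 ^ i \<le> real (k i) powr (1 / q (n i)) * ?A (k i)" and inc: "incseq k"
    using exists_unbounded_blocks[of q ?A \<delta>, OF q _ _ unbounded]
      schramm_sum_inv_one(1)[OF sch, of 1] schramm_sum_inv_one_antimono[OF sch, of 1] by auto
  \<comment> \<open>Halving the number of points makes the cells longer than 1/\<delta>, which leaves room for the shift,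
      and costs only a factor 2 in the norm.\<close>
  define m where "m i = (k i + 1) div 2" for i
  have m: "1 \<le> m i" "2 * m i \<le> 2 * k i" "k i \<le> 2 * m i" "real (m i) < \<delta> (n i)" for i
    using k[of i] k\<delta>[of i] \<delta>[OF n[of i]] unfolding m_def by auto
  have "\<exists>\<theta>. 0 < \<theta> \<and> \<theta> < 1 / m i - 1 / \<delta> (n i) \<and> \<theta> \<notin> \<rat>" for i
  proof (rule exists_small_irrational)
    have "1 / \<delta> (n i) < 1 / m i" using m[of i] by (intro divide_strict_left_mono) auto
    then show "0 < 1 / m i - 1 / \<delta> (n i)" by simp
  qed
  then obtain \<theta> where \<theta>: "\<And>i. 0 < \<theta> i" "\<And>i. \<theta> i < 1 / m i - 1 / \<delta> (n i)" "\<And>i. \<theta> i \<notin> \<rat>"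
    by metis
  define S where "S i = (\<lambda>j. (real j - 1) / m i + \<theta> i) ` {1..m i}" for i
  define b where "b i = (1 / 2) ^ i * ?A (k i)" for i
  define f where "f = spikes S b"
  have A0: "0 < ?A (k i)" for i using schramm_sum_inv_one(1)[OF sch k] .
  have S: "finite (S i)" "card (S i) \<le> m i" for i
    using card_image_le[of "{1..m i}"] by (auto simp: S_def)
  have "schramm_variation \<phi> f \<le> ereal 4"
    unfolding f_def b_def[abs_def]
  proof (rule spikes_variation_le[OF sch S(1)])
    show "0 \<le> ?A (k i)" for i using A0[of i] by simp
    show "schramm_sum \<phi> (2 * card (S i)) (?A (k i)) \<le> 2" for i
    proof -
      have "schramm_sum \<phi> (2 * card (S i)) (?A (k i)) \<le> schramm_sum \<phi> (2 * k i) (?A (k i))"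
        using S(2)[of i] m(2)[of i] A0[of i] by (intro schramm_sum_mono_index[OF sch]) auto
      moreover have "real (k i) * schramm_sum \<phi> (2 * k i) (?A (k i))
          \<le> real (2 * k i) * schramm_sum \<phi> (k i) (?A (k i))"
        using k[of i] A0[of i] by (intro schramm_sum_average_antimono[OF sch]) auto
      ultimately show ?thesis
        using schramm_sum_inv_one(2)[OF sch k[of i]] k[of i] by simp
    qed
  qed
  then have "f \<in> Phi_BV \<phi>" by (auto simp: Phi_BV_def intro!: exI[of _ 1])
  then have fin: "(SUP n\<in>{1..}. q_variation (q n) (\<delta> n) f) < \<infinity>"
    using sub by (auto simp: BV_seq_def)
  have "antimono b"
  proof (rule decseq_SucI)
    fix i
    have "?A (k (Suc i)) \<le> ?A (k i)"
      using incseqD[OF inc, of i "Suc i"] k[of i] by (intro schramm_sum_inv_one_antimono[OF sch]) auto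
    then show "b (Suc i) \<le> b i"
      unfolding b_def using A0[of "Suc i"] by (intro mult_mono) auto
  qed
  \<comment> \<open>With this, f vanishes at every rational, in particular at the right ends of the test intervals.\<close>
  have irr: "x \<notin> S i" if "x \<in> \<rat>" for x i
  proof
    assume "x \<in> S i"
    then obtain j where "\<theta> i = x - (real j - 1) / m i" by (auto simp: S_def)
    then have "\<theta> i \<in> \<rat>" using that by auto
    then show False using \<theta>(3) by blast
  qed
  have large: "ereal (2 ^ i / 2) \<le> (SUP n\<in>{1..}. q_variation (q n) (\<delta> n) f)" for i
  proof -
    let ?r = "1 / q (n i)"
    have r: "0 \<le> ?r" "?r \<le> 1" using q[OF n[of i]] by auto
    have b0: "0 \<le> b i" using A0[of i] by (simp add: b_def)
    have "2 ^ i / 2 = 4 ^ i * (1 / 2) ^ i * (1 / 2 :: real)"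
      by (simp flip: power_mult_distrib)
    also have "\<dots> \<le> (real (k i) powr ?r * ?A (k i)) * (1 / 2) ^ i * (1 / 2) powr ?r"
    proof (intro mult_mono big)
      show "1 / 2 \<le> (1 / 2 :: real) powr ?r" using powr_mono'[of ?r 1 "1/2"] r by simp
    qed (use A0[of i] in auto)
    also have "\<dots> = (real (k i) / 2) powr ?r * b i"
      by (simp add: b_def powr_divide)
    also have "\<dots> \<le> real (m i) powr ?r * b i"
      using m(3)[of i] r b0 by (intro mult_right_mono powr_mono2) auto
    finally have "ereal (2 ^ i / 2) \<le> ereal (real (m i) powr ?r * b i)" by simp
    also have "\<dots> \<le> q_variation (q (n i)) (\<delta> (n i)) f"
    proof (rule q_variation_ge_on_shifted_grid[where \<theta> = "\<theta> i"])
      show "b i \<le> \<bar>f (real j / m i) - f ((real j - 1) / m i + \<theta> i)\<bar>" if "j \<in> {1..m i}" for j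
      proof -
        have "real j / m i \<in> \<rat>" by auto
        then have "f (real j / m i) = 0" using irr by (auto simp: f_def spikes_def)
        moreover have "b i \<le> f ((real j - 1) / m i + \<theta> i)"
          unfolding f_def using that by (intro spikes_ge[OF \<open>antimono b\<close>]) (auto simp: S_def)
        ultimately show ?thesis by simp
      qed
    qed (use q[OF n[of i]] \<delta>[OF n[of i]] m(1)[of i] \<theta>(1)[of i] \<theta>(2)[of i] b0 in auto)
    also have "\<dots> \<le> (SUP n\<in>{1..}. q_variation (q n) (\<delta> n) f)"
      using n[of i] by (intro SUP_upper) auto
    finally show ?thesis .
  qed
  show False
  proof (cases "SUP n\<in>{1..}. q_variation (q n) (\<delta> n) f")
    case (real r)
    obtain i where "2 * r < 2 ^ i" using real_arch_pow[of 2 "2 * r"] by auto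
    then show False using large[of i] unfolding real by simp
  next
    case PInf
    then show False using fin by simp
  next
    case MInf
    then show False using large[of 0] by simp
  qed
qed

theorem theorem1p8:
  fixes \<phi> :: "nat \<Rightarrow> real \<Rightarrow> real"
    and q \<delta> :: "nat \<Rightarrow> real"
    and q_lim :: ereal
  assumes "schramm_sequence \<phi>"
    and "\<And>n. n \<ge> 1 \<Longrightarrow> 1 \<le> q n"
    and "mono_on {1..} q"
    and "(\<lambda>n. ereal (q n)) \<longlonglongrightarrow> q_lim"
    and "\<And>n. n \<ge> 1 \<Longrightarrow> 2 \<le> \<delta> n"
    and "mono_on {1..} \<delta>"
    and "filterlim \<delta> at_top sequentially"
  shows "Phi_BV \<phi> \<subseteq> BV_seq q \<delta> \<longleftrightarrow>
    limsup (\<lambda>n. ereal (MAX k\<in>{k::nat. 1 \<le> k \<and> real k \<le> \<delta> n}.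
                         real k powr (1 / q n) * schramm_sum_inv \<phi> k 1)) < \<infinity>"
proof -
  define K where "K n = {k::nat. 1 \<le> k \<and> real k \<le> \<delta> n}" for n
  define h where "h n k = real k powr (1 / q n) * schramm_sum_inv \<phi> k 1" for n k
  have K: "finite (K n)" for n
    by (rule finite_subset[of _ "{..nat \<lfloor>\<delta> n\<rfloor>}"]) (auto simp: K_def le_nat_floor)
  have K_ne: "K n \<noteq> {}" if "n \<ge> 1" for n
    using assms(5)[OF that] by (auto simp: K_def intro!: exI[of _ 1])
  have \<delta>: "1 < \<delta> n" if "n \<ge> 1" for n using assms(5)[OF that] by simp
  have "Phi_BV \<phi> \<subseteq> BV_seq q \<delta> \<longleftrightarrow> limsup (\<lambda>n. ereal (MAX k\<in>K n. h n k)) < \<infinity>"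
  proof
    assume "Phi_BV \<phi> \<subseteq> BV_seq q \<delta>"
    have "\<exists>C. \<forall>n\<ge>1. \<forall>k\<ge>1. real k \<le> \<delta> n \<longrightarrow> h n k \<le> C"
    proof (rule ccontr)
      assume "\<not> ?thesis"
      then have unbounded: "\<exists>n\<ge>1. \<exists>k\<ge>1. real k \<le> \<delta> n \<and>
          C < real k powr (1 / q n) * schramm_sum_inv \<phi> k 1" for C
        unfolding h_def by (meson not_le)
      have "\<not> Phi_BV \<phi> \<subseteq> BV_seq q \<delta>"
        using assms(2) \<delta> unbounded by (rule not_Phi_BV_subset_BV_seq[OF assms(1)])
      then show False using \<open>Phi_BV \<phi> \<subseteq> BV_seq q \<delta>\<close> by contradiction
    qed
    then obtain C where C: "\<And>n k. n \<ge> 1 \<Longrightarrow> k \<ge> 1 \<Longrightarrow> real k \<le> \<delta> n \<Longrightarrow> h n k \<le> C"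
      by blast
    have "(MAX k\<in>K n. h n k) \<le> C" if "n \<ge> 1" for n
      using K[of n] K_ne[OF that] C[OF that] by (intro Max.boundedI) (auto simp: K_def)
    then have "limsup (\<lambda>n. ereal (MAX k\<in>K n. h n k)) \<le> ereal C"
      by (intro Limsup_bounded eventually_sequentiallyI[of 1]) auto
    then show "limsup (\<lambda>n. ereal (MAX k\<in>K n. h n k)) < \<infinity>" by auto
  next
    assume "limsup (\<lambda>n. ereal (MAX k\<in>K n. h n k)) < \<infinity>"
    then obtain C where "limsup (\<lambda>n. ereal (MAX k\<in>K n. h n k)) < ereal C"
      using ereal_dense2 by blast
    then have "eventually (\<lambda>n. ereal (MAX k\<in>K n. h n k) < ereal C) sequentially"
      by (rule Limsup_lessD)
    then obtain N where N: "\<And>n. n \<ge> N \<Longrightarrow> (MAX k\<in>K n. h n k) < C"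
      by (auto simp: eventually_sequentially)
    \<comment> \<open>The finitely many n with uncontrolled maxima are absorbed into the bound.\<close>
    define M where "M = max 1 C + (\<Sum>n<N. \<bar>MAX k\<in>K n. h n k\<bar>)"
    have pos: "0 \<le> (\<Sum>n<N. \<bar>MAX k\<in>K n. h n k\<bar>)" by (intro sum_nonneg) auto
    have "(MAX k\<in>K n. h n k) \<le> M" for n
    proof (cases "n < N")
      case True
      then have "\<bar>MAX k\<in>K n. h n k\<bar> \<le> (\<Sum>n<N. \<bar>MAX k\<in>K n. h n k\<bar>)"
        by (intro member_le_sum) auto
      then show ?thesis by (simp add: M_def)
    next
      case False
      then have "(MAX k\<in>K n. h n k) < C" using N[of n] by simp
      then show ?thesis unfolding M_def using pos max.cobounded2[of C 1] by linarith
    qed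
    moreover have "h n k \<le> (MAX k\<in>K n. h n k)" if "1 \<le> k" "real k \<le> \<delta> n" for n k
      using that K[of n] by (intro Max_ge) (auto simp: K_def)
    ultimately have "h n k \<le> M" if "1 \<le> k" "real k \<le> \<delta> n" for n k
      using that order_trans by blast
    moreover have "0 < M" unfolding M_def using pos max.cobounded1[of 1 C] by linarith
    ultimately show "Phi_BV \<phi> \<subseteq> BV_seq q \<delta>"
      using \<delta> unfolding h_def
      by (intro Phi_BV_subset_BV_seq[OF assms(1,2)]) force+
  qed
  then show ?thesis by (simp only: K_def h_def)
qed

end
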